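(* Let $i\in\mathcal H$ be any benign agent. Suppose that in $SCC(\cdot)$ agent $i$ chooses a clipping parameter $\tau_i$ to clip its received messages and in $ARC(\cdot)$ it clips $b_i$ messages. Then the robust aggregation rule $SCC(ARC(\cdot))$ satisfies $$\|SCC(ARC(\lambda_i,\{\check\lambda_j\}_{j\in\mathcal N_i}))\|\le\max_{j\in(\mathcal N_i\cap\mathcal H)\cup\{i\}}\|\lambda_j\|$$ for all messages $\lambda_i,\{\check\lambda_j\}_{j\in\mathcal N_i}$ in $\mathbb R^d$.
   Context: Setting: $\mathcal M$ is a set of $M$ agents, the disjoint union of benign agents $\mathcal H$ and Byzantine agents $\mathcal B$, connected by an undirected connected graph $\widetilde{\mathcal G}=(\mathcal M,\widetilde{\mathcal E})$; $\mathcal N_i$ is the set of neighbors of $i$. $\widetilde E=[\widetilde e_{ij}]\in\mathbb R^{M\times M}$ is doubly stochastic, with $\widetilde e_{ij}>0$ if and only if $(i,j)\in\widetilde{\mathcal E}$ or $i=j$. Each benign agent $i$ holds $\lambda_i\in\mathbb R^d$ and receives messages $\check\lambda_j\in\mathbb R^d$, $j\in\mathcal N_i$, with $\check\lambda_j=\lambda_j$ if $j\in\mathcal H$ and $\check\lambda_j$ arbitrary if $j\in\mathcal B$. Throughout, $b_i$ is an upper bound on the number of Byzantine neighbors, $|\mathcal N_i\cap\mathcal B|\le b_i$, with $b_i+1\le|\mathcal N_i|$ so that $ARC$ is well defined; $\tau_i\ge0$. Clipping: $clip_C(x):=\min(1,C/\|x\|)\,x$ for $C\ge0$ (and $clip_C(0)=0$);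 also $clip(x,\tau):=\min(1,\tau/\|x\|)\,x$ (and $clip(0,\tau)=0$). $ARC$: let $C_i$ be the $(b_i+1)$-th largest among the norms $\|\check\lambda_j\|$, $j\in\mathcal N_i$; then $ARC(\lambda_i,\{\check\lambda_j\}_{j\in\mathcal N_i})=\{\lambda_i,\{clip_{C_i}(\check\lambda_j)\}_{j\in\mathcal N_i}\}$ (own vector not clipped). $SCC(ARC(\cdot))$: $$SCC(ARC(\lambda_i,\{\check\lambda_j\}_{j\in\mathcal N_i}))=\widetilde e_{ii}\lambda_i+\sum_{j\in\mathcal N_i}\widetilde e_{ij}\big[\lambda_i+clip(clip_{C_i}(\check\lambda_j)-\lambda_i,\tau_i)\big].$$ *)

theory Defs
  imports "HOL-Analysis.Analysis" "HOL-Library.Multiset" "Graph_Theory.Graph_Theory"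
begin

text \<open>
  Finite simple undirected graphs are rendered as in \<^theory>\<open>Graph_Theory.Pair_Digraph\<close>:
  \<^locale>\<open>pair_graph\<close> describes a finite, symmetric, loop-free relation on a finite vertex set.
\<close>

definition neighbors :: "'a pair_pre_digraph \<Rightarrow> 'a \<Rightarrow> 'a set" where
  "neighbors G i = {j. (i, j) \<in> parcs G}"

definition doubly_stochastic_on :: "'a set \<Rightarrow> ('a \<Rightarrow> 'a \<Rightarrow> real) \<Rightarrow> bool" where
  "doubly_stochastic_on V E \<longleftrightarrow>
     (\<forall>i\<in>V. \<forall>j\<in>V. 0 \<le> E i j) \<and>
     (\<forall>i\<in>V. (\<Sum>j\<in>V. E i j) = 1) \<and>
     (\<forall>j\<in>V. (\<Sum>i\<in>V. E i j) = 1)"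

text \<open>Because \<^term>\<open>c / 0 = (0::real)\<close>, the convention that clipping fixes 0 needs no case distinction.\<close>

definition clip :: "'v::real_normed_vector \<Rightarrow> real \<Rightarrow> 'v" where
  "clip x c = min 1 (c / norm x) *\<^sub>R x"

text \<open>
  Values are counted with multiplicity, and \<open>b\<close> is a zero-based index into the descending list:
  the result is the \<open>(b + 1)\<close>-th largest value, meaningful only for \<^term>\<open>b < card N\<close>.
\<close>

definition nth_largest :: "('a \<Rightarrow> real) \<Rightarrow> 'a set \<Rightarrow> nat \<Rightarrow> real" where
  "nth_largest f N b = rev (sorted_list_of_multiset (image_mset f (mset_set N))) ! b"

text \<open>
  A collection of messages is a pair: the agent's own vector, and the family of received vectors
  (of which only the members indexed by the neighbor set \<open>N\<close> matter).
\<close>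

definition ARC :: "'a set \<Rightarrow> nat \<Rightarrow> 'v::real_normed_vector \<times> ('a \<Rightarrow> 'v) \<Rightarrow> 'v \<times> ('a \<Rightarrow> 'v)" where
  "ARC N b = (\<lambda>(x, y).
     let C = nth_largest (\<lambda>j. norm (y j)) N b in (x, \<lambda>j. clip (y j) C))"

definition SCC ::
  "('a \<Rightarrow> 'a \<Rightarrow> real) \<Rightarrow> 'a \<Rightarrow> 'a set \<Rightarrow> real \<Rightarrow> 'v::real_normed_vector \<times> ('a \<Rightarrow> 'v) \<Rightarrow> 'v" where
  "SCC E i N \<tau> = (\<lambda>(x, y).
     E i i *\<^sub>R x + (\<Sum>j\<in>N. E i j *\<^sub>R (x + clip (y j - x) \<tau>)))"

end

theory Submission
  imports Defs
begin

text \<open>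
  The threshold \<open>C\<close> of ARC is the \<open>(b + 1)\<close>-th largest received norm, so at least \<open>b + 1\<close> neighbors
  send a message of norm at least \<open>C\<close>. At most \<open>b\<close> neighbors are Byzantine, so one of these senders
  is benign, and \<open>C\<close> is bounded by the norm of a benign neighbor's vector
  (\<open>nth_largest_le_outside\<close>). Hence after ARC the agent's own vector and all messages lie in the
  closed ball around 0 whose radius is the maximal norm of a benign vector in the closed
  neighborhood.

  SCC cannot leave this ball, because the ball is convex: clipping the difference \<open>y - x\<close> only
  shortens the step from \<open>x\<close> towards \<open>y\<close>, and the output averages the shortened steps with a row of
  a stochastic matrix (\<open>SCC_in_convex\<close>). The row's weights on the closed neighborhood add up to 1
  because the support of the matrix is the edge set together with the diagonal.
\<close>

lemma norm_clip_le: "0 \<le> c \<Longrightarrow> norm (clip x c) \<le> c"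
  by (cases "x = 0") (auto simp: clip_def min_def field_simps)

text \<open>
  Clipping multiplies by a factor in \<open>[0, 1]\<close>, so the clipped step ends on the segment from \<open>x\<close>
  to \<open>y\<close>.
\<close>

lemma clipped_step_in_convex:
  assumes "convex S" "x \<in> S" "y \<in> S" "0 \<le> c"
  shows "x + clip (y - x) c \<in> S"
proof -
  define t where "t = min 1 (c / norm (y - x))"
  have t: "0 \<le> t" "t \<le> 1" using assms(4) by (auto simp: t_def)
  have "x + clip (y - x) c = (1 - t) *\<^sub>R x + t *\<^sub>R y"
    by (simp add: clip_def t_def algebra_simps)
  then show ?thesis using convexD_alt[OF assms(1-3) t] by simp
qed

lemma SCC_in_convex:
  assumes "convex S" "x \<in> S" and y: "\<And>j. j \<in> N \<Longrightarrow> y j \<in> S" and "0 \<le> \<tau>"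
    and N: "finite N" "i \<notin> N"
    and E: "\<And>j. j \<in> insert i N \<Longrightarrow> 0 \<le> E i j" "(\<Sum>j\<in>insert i N. E i j) = 1"
  shows "SCC E i N \<tau> (x, y) \<in> S"
proof -
  let ?z = "\<lambda>j. if j = i then x else x + clip (y j - x) \<tau>"
  have "(\<Sum>j\<in>insert i N. E i j *\<^sub>R ?z j) \<in> S"
    using N E assms(2) clipped_step_in_convex[OF assms(1,2) y assms(4)]
    by (intro convex_sum[OF _ assms(1)]) auto
  moreover have "(\<Sum>j\<in>N. E i j *\<^sub>R ?z j) = (\<Sum>j\<in>N. E i j *\<^sub>R (x + clip (y j - x) \<tau>))"
    using N(2) by (intro sum.cong) auto
  ultimately show ?thesis using N by (simp add: SCC_def)
qed

text \<open>
  The first \<open>b + 1\<close> entries of the descending list are all at least the entry at index \<open>b\<close>.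
  Counting list entries, rather than values, accounts for ties.
\<close>

lemma card_ge_nth_largest:
  assumes "finite N" "b < card N"
  shows "b < card {j \<in> N. nth_largest f N b \<le> f j}"
proof -
  define M where "M = image_mset f (mset_set N)"
  define L where "L = rev (sorted_list_of_multiset M)"
  define c where "c = nth_largest f N b"
  have c: "c = L ! b" by (simp add: c_def nth_largest_def L_def M_def)
  have mL: "mset L = M" by (simp add: L_def)
  then have len: "length L = card N" by (simp add: M_def flip: size_mset)
  have srt: "sorted_wrt (\<ge>) L"
    by (simp add: L_def sorted_wrt_rev)
  have "c \<le> x" if "x \<in> set (take (Suc b) L)" for x
  proof -
    from that obtain k where k: "k \<le> b" "k < length L" "x = L ! k"
      by (auto simp: in_set_conv_nth less_Suc_eq_le)
    then show ?thesis
      using sorted_wrt_nth_less[OF srt, of k b] assms(2) len c by (cases "k = b") auto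
  qed
  then have "filter ((\<le>) c) (take (Suc b) L) = take (Suc b) L" by simp
  then have "Suc b \<le> length (filter ((\<le>) c) (take (Suc b) L @ drop (Suc b) L))"
    using assms(2) len by (simp only: filter_append length_append) simp
  also have "\<dots> = size (filter_mset ((\<le>) c) M)"
    by (simp flip: mL mset_filter)
  also have "\<dots> = card {j \<in> N. c \<le> f j}"
    using assms(1) by (simp add: M_def filter_mset_image_mset filter_mset_mset_set)
  finally show ?thesis by (simp add: c_def)
qed

lemma nth_largest_in_image:
  assumes "finite N" "b < card N"
  shows "nth_largest f N b \<in> f ` N"
proof -
  let ?L = "rev (sorted_list_of_multiset (image_mset f (mset_set N)))"
  have "length ?L = card N"
    by (simp flip: size_mset)
  then have "?L ! b \<in> set ?L" using assms(2) by (metis nth_mem)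
  then show ?thesis using assms(1) by (simp add: nth_largest_def)
qed

text \<open>
  Pigeonhole: the at least \<open>b + 1\<close> elements whose value reaches the \<open>(b + 1)\<close>-th largest one
  cannot all lie in a set meeting \<open>N\<close> in at most \<open>b\<close> elements.
\<close>

lemma nth_largest_le_outside:
  assumes "finite N" "b < card N" "card (N \<inter> B) \<le> b"
  obtains k where "k \<in> N" "k \<notin> B" "nth_largest f N b \<le> f k"
proof -
  let ?T = "{j \<in> N. nth_largest f N b \<le> f j}"
  have "\<not> ?T \<subseteq> N \<inter> B"
    using card_mono[of "N \<inter> B" ?T] card_ge_nth_largest[OF assms(1,2), of f] assms by auto
  then show ?thesis using that by blast
qed

theorem lemma12:
  fixes G :: "'a pair_pre_digraph"
    and H B :: "'a set"
    and E :: "'a \<Rightarrow> 'a \<Rightarrow> real"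
    and b :: "'a \<Rightarrow> nat"
    and \<tau> :: "'a \<Rightarrow> real"
    and lam lam_recv :: "'a \<Rightarrow> real ^ 'd"
    and i :: 'a
  assumes "pair_graph G"
    and "Digraph_Component.connected (with_proj G)"
    and "pverts G = H \<union> B" and "H \<inter> B = {}"
    and "doubly_stochastic_on (pverts G) E"
    and "\<And>j k. j \<in> pverts G \<Longrightarrow> k \<in> pverts G \<Longrightarrow> E j k > 0 \<longleftrightarrow> (j, k) \<in> parcs G \<or> j = k"
    and "i \<in> H"
    and "card (neighbors G i \<inter> B) \<le> b i"
    and "b i + 1 \<le> card (neighbors G i)"
    and "\<tau> i \<ge> 0"
    and "\<And>j. j \<in> neighbors G i \<inter> H \<Longrightarrow> lam_recv j = lam j"
  shows "norm (SCC E i (neighbors G i) (\<tau> i) (ARC (neighbors G i) (b i) (lam i, lam_recv)))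
    \<le> Max ((\<lambda>j. norm (lam j)) ` (neighbors G i \<inter> H \<union> {i}))"
proof -
  interpret pair_graph G by fact
  define N where "N = neighbors G i"
  define r where "r = Max ((\<lambda>j. norm (lam j)) ` (N \<inter> H \<union> {i}))"
  define C where "C = nth_largest (\<lambda>j. norm (lam_recv j)) N (b i)"
  have iV: "i \<in> pverts G" using assms(3,7) by simp
  have NV: "N \<subseteq> pverts G" "i \<notin> N"
    using in_arcsD2 no_loops' by (auto simp: N_def neighbors_def)
  then have finN: "finite N" using pair_finite_verts finite_subset by blast
  have r: "norm (lam j) \<le> r" if "j \<in> N \<inter> H \<union> {i}" for j
    using that finN by (auto simp: r_def intro!: Max_ge)
  have bN: "b i < card N" "card (N \<inter> B) \<le> b i" using assms(8,9) by (auto simp: N_def)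
  have "C \<in> (\<lambda>j. norm (lam_recv j)) ` N"
    unfolding C_def by (rule nth_largest_in_image[OF finN bN(1)])
  then have C0: "0 \<le> C" by auto
  obtain k where k: "k \<in> N" "k \<notin> B" "C \<le> norm (lam_recv k)"
    unfolding C_def by (rule nth_largest_le_outside[OF finN bN])
  then have kH: "k \<in> N \<inter> H" using NV(1) assms(3) by auto
  then have "lam_recv k = lam k" using assms(11) by (simp add: N_def)
  with k(3) r[of k] kH have Cr: "C \<le> r" by auto
  have nonneg: "0 \<le> E i j" if "j \<in> pverts G" for j
    using assms(5) iV that by (auto simp: doubly_stochastic_on_def)
  have supp: "E i j = 0" if "j \<in> pverts G - insert i N" for j
    using assms(6)[OF iV, of j] nonneg[of j] that by (auto simp: N_def neighbors_def)
  have "(\<Sum>j\<in>insert i N. E i j) = (\<Sum>j\<in>pverts G. E i j)"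
    using supp NV(1) iV by (intro sum.mono_neutral_left) auto
  then have row: "(\<Sum>j\<in>insert i N. E i j) = 1"
    using assms(5) iV by (simp add: doubly_stochastic_on_def)
  have "SCC E i N (\<tau> i) (lam i, \<lambda>j. clip (lam_recv j) C) \<in> cball 0 r"
  proof (rule SCC_in_convex)
    show "clip (lam_recv j) C \<in> cball 0 r" for j
      using norm_clip_le[OF C0, of "lam_recv j"] Cr by simp
  qed (use r[of i] nonneg iV NV finN row assms(10) in auto)
  then show ?thesis by (simp add: ARC_def C_def N_def r_def)
qed

end
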